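(* Let $\Re$ be a complete and reduced rewriting system over $\Sigma$. If $\Re$ is cyclically complete, then any word $w$ in $\Sigma^{*}$ has a unique cyclically irreducible form (up to $\bumpeq$). Moreover, if $\widetilde{w}\bumpeq w$, then $w$ and $\widetilde{w}$ have the same cyclically irreducible form (up to $\bumpeq$).
   Context: A rewriting system $\Re$ over $\Sigma$ is a (possibly infinite) set of rules $l\rightarrow r$ with $l,r\in\Sigma^{*}$; one writes $plq\rightarrow prq$ for a rule $l\rightarrow r$ and words $p,q$. It is complete if terminating and confluent; reduced if for every rule $l\rightarrow r$ the word $r$ is irreducible and no other rule has its left-hand side a subword of $l$. Words $u,v$ are cyclic conjugates, $u\bumpeq v$, if $u=pq$ and $v=qp$ in $\Sigma^{*}$ for some (possibly empty) words $p,q$. One writes $u\looparrowright v$ if there is $\widetilde u\bumpeq u$ with $\widetilde u\rightarrow v$ (one rewriting step); $\looparrowright^{*}$ is the reflexive transitive closure of $\looparrowright$. $\Re$ is cyclically terminating if there is no infinite sequence $u_1\looparrowright u_2\looparrowright\cdots$. $\Re$ is cyclically confluent if whenever $w\looparrowright^{*}u$ and $w\looparrowright^{*}v$ there are words $z\bumpeq z'$ with $u\looparrowright^{*}z$ and $v\looparrowright^{*}z'$. $\Re$ is cyclically complete if it is cyclically terminating and cyclically confluent. A word is cyclically irreducible if it and all its cyclic conjugates are irreducible for $\rightarrow$. A cyclically irreducible form of $w$ is a cyclically irreducible word $v$ with $w\looparrowright^{*}v$, considered up to $\bumpeq$. *)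

theory Defs
  imports Main "HOL-Library.Sublist" "HOL-Library.Confluence"
begin

definition rewriting_system :: "'a set \<Rightarrow> ('a list \<times> 'a list) set \<Rightarrow> bool" where
  "rewriting_system \<Sigma> R \<longleftrightarrow> R \<subseteq> lists \<Sigma> \<times> lists \<Sigma>"

definition rstep :: "'a set \<Rightarrow> ('a list \<times> 'a list) set \<Rightarrow> 'a list \<Rightarrow> 'a list \<Rightarrow> bool" where
  "rstep \<Sigma> R u v \<longleftrightarrow>
     (\<exists>p\<in>lists \<Sigma>. \<exists>q\<in>lists \<Sigma>. \<exists>(l, r)\<in>R. u = p @ l @ q \<and> v = p @ r @ q)"

definition no_infinite_chain :: "('b \<Rightarrow> 'b \<Rightarrow> bool) \<Rightarrow> bool" where
  "no_infinite_chain s \<longleftrightarrow> \<not> (\<exists>f :: nat \<Rightarrow> 'b. \<forall>i. s (f i) (f (Suc i)))"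

definition complete_rs :: "'a set \<Rightarrow> ('a list \<times> 'a list) set \<Rightarrow> bool" where
  "complete_rs \<Sigma> R \<longleftrightarrow> no_infinite_chain (rstep \<Sigma> R) \<and> confluentp (rstep \<Sigma> R)"

definition irreducible_word :: "'a set \<Rightarrow> ('a list \<times> 'a list) set \<Rightarrow> 'a list \<Rightarrow> bool" where
  "irreducible_word \<Sigma> R u \<longleftrightarrow> \<not> (\<exists>v. rstep \<Sigma> R u v)"

text \<open>The comparison in \<open>reduced_rs\<close> is between rules, not left-hand sides, so two
  distinct rules with the same left-hand side are excluded.\<close>

definition reduced_rs :: "'a set \<Rightarrow> ('a list \<times> 'a list) set \<Rightarrow> bool" where
  "reduced_rs \<Sigma> R \<longleftrightarrow>
     (\<forall>(l, r)\<in>R. irreducible_word \<Sigma> R r \<and>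
        (\<forall>(l', r')\<in>R. (l', r') \<noteq> (l, r) \<longrightarrow> \<not> sublist l' l))"

definition cyc_conj :: "'a list \<Rightarrow> 'a list \<Rightarrow> bool" (infix "\<bumpeq>" 50) where
  "u \<bumpeq> v \<longleftrightarrow> (\<exists>p q. u = p @ q \<and> v = q @ p)"

definition cyc_step :: "'a set \<Rightarrow> ('a list \<times> 'a list) set \<Rightarrow> 'a list \<Rightarrow> 'a list \<Rightarrow> bool" where
  "cyc_step \<Sigma> R u v \<longleftrightarrow> (\<exists>u'. u' \<bumpeq> u \<and> rstep \<Sigma> R u' v)"

definition cyc_confluent :: "'a set \<Rightarrow> ('a list \<times> 'a list) set \<Rightarrow> bool" where
  "cyc_confluent \<Sigma> R \<longleftrightarrow>
     (\<forall>w\<in>lists \<Sigma>. \<forall>u v. (cyc_step \<Sigma> R)\<^sup>*\<^sup>* w u \<and> (cyc_step \<Sigma> R)\<^sup>*\<^sup>* w v \<longrightarrow>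
        (\<exists>z z'. z \<bumpeq> z' \<and> (cyc_step \<Sigma> R)\<^sup>*\<^sup>* u z \<and> (cyc_step \<Sigma> R)\<^sup>*\<^sup>* v z'))"

definition cyc_complete :: "'a set \<Rightarrow> ('a list \<times> 'a list) set \<Rightarrow> bool" where
  "cyc_complete \<Sigma> R \<longleftrightarrow> no_infinite_chain (cyc_step \<Sigma> R) \<and> cyc_confluent \<Sigma> R"

definition cyc_irreducible :: "'a set \<Rightarrow> ('a list \<times> 'a list) set \<Rightarrow> 'a list \<Rightarrow> bool" where
  "cyc_irreducible \<Sigma> R u \<longleftrightarrow>
     irreducible_word \<Sigma> R u \<and> (\<forall>u'. u' \<bumpeq> u \<longrightarrow> irreducible_word \<Sigma> R u')"

definition cyc_irreducible_form ::
  "'a set \<Rightarrow> ('a list \<times> 'a list) set \<Rightarrow> 'a list \<Rightarrow> 'a list \<Rightarrow> bool" where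
  "cyc_irreducible_form \<Sigma> R w v \<longleftrightarrow> cyc_irreducible \<Sigma> R v \<and> (cyc_step \<Sigma> R)\<^sup>*\<^sup>* w v"

end

theory Submission
  imports Defs
begin

text \<open>Cyclically irreducible words are exactly the normal forms of \<open>cyc_step\<close>.
  Cyclic termination therefore gives every word such a form
  (\<open>cyc_irreducible_form_exists\<close>). Two forms of one word are joined, by cyclic
  confluence, at conjugate words; as neither form admits a step, they are themselves conjugate
  (\<open>cyc_irreducible_form_unique\<close>). Since \<open>cyc_step\<close> may conjugate before
  rewriting, its successors depend only on the conjugacy class of the source. A form of one
  conjugate thus transfers, up to \<bumpeq>, to any other
  (\<open>cyc_irreducible_form_cyc_conj\<close>).\<close>

lemma cyc_conj_iff_rotate: "u \<bumpeq> v \<longleftrightarrow> (\<exists>n. v = rotate n u)"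
proof
  assume "u \<bumpeq> v"
  then show "\<exists>n. v = rotate n u"
    unfolding cyc_conj_def by (metis rotate_append)
next
  assume "\<exists>n. v = rotate n u"
  then obtain n where "v = rotate n u" ..
  then have "v = drop (n mod length u) u @ take (n mod length u) u"
    by (simp add: rotate_drop_take)
  then show "u \<bumpeq> v"
    unfolding cyc_conj_def using append_take_drop_id[symmetric] by blast
qed

lemma cyc_conj_refl: "u \<bumpeq> u"
  unfolding cyc_conj_def by (rule exI[of _ "[]"]) simp

lemma cyc_conj_sym: "u \<bumpeq> v \<Longrightarrow> v \<bumpeq> u"
  unfolding cyc_conj_def by blast

text \<open>Rotations compose by adding their amounts; working with the two splittings of
  \<open>v\<close> would require comparing the cut points.\<close>

lemma cyc_conj_trans: "u \<bumpeq> v \<Longrightarrow> v \<bumpeq> w \<Longrightarrow> u \<bumpeq> w"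
  unfolding cyc_conj_iff_rotate by (metis rotate_rotate)

text \<open>This turns a condition on all conjugates into being a normal form of a single relation,
  so that the usual arguments of abstract rewriting apply.\<close>

lemma cyc_irreducible_iff_no_cyc_step:
  "cyc_irreducible \<Sigma> R u \<longleftrightarrow> (\<nexists>v. cyc_step \<Sigma> R u v)"
  unfolding cyc_irreducible_def irreducible_word_def cyc_step_def
  using cyc_conj_refl by blast

text \<open>The conjugation built into a step absorbs one more conjugation of its source, by
  transitivity.\<close>

lemma cyc_step_cyc_conj: "u' \<bumpeq> u \<Longrightarrow> cyc_step \<Sigma> R u' v \<Longrightarrow> cyc_step \<Sigma> R u v"
  unfolding cyc_step_def by (blast intro: cyc_conj_trans)

lemma cyc_irreducible_cyc_steps_eq:
  assumes "cyc_irreducible \<Sigma> R u" and "(cyc_step \<Sigma> R)\<^sup>*\<^sup>* u v"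
  shows "v = u"
  using assms(2,1) unfolding cyc_irreducible_iff_no_cyc_step
  by (auto elim: converse_rtranclpE)

lemma cyc_irreducible_form_exists:
  assumes "no_infinite_chain (cyc_step \<Sigma> R)"
  shows "\<exists>v. cyc_irreducible_form \<Sigma> R w v"
proof -
  \<comment> \<open>The relation is reversed: reducts count as smaller, so induction may assume the
    claim for every one-step reduct of \<open>w\<close>.\<close>
  have "wf {(v, u). cyc_step \<Sigma> R u v}"
    using assms unfolding no_infinite_chain_def wf_iff_no_infinite_down_chain by simp
  then show ?thesis
  proof (induction w rule: wf_induct_rule)
    case (less w)
    show ?case
    proof (cases "cyc_irreducible \<Sigma> R w")
      case True
      then show ?thesis
        unfolding cyc_irreducible_form_def by blast
    next
      case False
      then obtain u where u: "cyc_step \<Sigma> R w u"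
        unfolding cyc_irreducible_iff_no_cyc_step by blast
      with less.IH obtain v where "cyc_irreducible_form \<Sigma> R u v"
        by blast
      with u show ?thesis
        unfolding cyc_irreducible_form_def by (blast intro: converse_rtranclp_into_rtranclp)
    qed
  qed
qed

lemma cyc_irreducible_form_unique:
  assumes "cyc_confluent \<Sigma> R" and "w \<in> lists \<Sigma>"
    and "cyc_irreducible_form \<Sigma> R w v" and "cyc_irreducible_form \<Sigma> R w v'"
  shows "v' \<bumpeq> v"
proof -
  have irr: "cyc_irreducible \<Sigma> R v" "cyc_irreducible \<Sigma> R v'"
    and steps: "(cyc_step \<Sigma> R)\<^sup>*\<^sup>* w v" "(cyc_step \<Sigma> R)\<^sup>*\<^sup>* w v'"
    using assms(3,4) unfolding cyc_irreducible_form_def by auto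
  obtain z z' where z: "z \<bumpeq> z'" "(cyc_step \<Sigma> R)\<^sup>*\<^sup>* v z" "(cyc_step \<Sigma> R)\<^sup>*\<^sup>* v' z'"
    using assms(1,2) steps unfolding cyc_confluent_def by blast
  then have "z = v" "z' = v'"
    using irr by (auto dest: cyc_irreducible_cyc_steps_eq)
  with z(1) show ?thesis
    by (simp add: cyc_conj_sym)
qed

text \<open>A nonempty cyclic derivation from \<open>w'\<close> is also one from \<open>w\<close>, since its first step
  may begin with any conjugation; the empty derivation forces \<open>v' = w'\<close>.\<close>

lemma cyc_irreducible_form_cyc_conj:
  assumes "w' \<bumpeq> w" and "cyc_irreducible_form \<Sigma> R w' v'"
  shows "\<exists>v. v' \<bumpeq> v \<and> cyc_irreducible_form \<Sigma> R w v"
proof -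
  have irr: "cyc_irreducible \<Sigma> R v'" and steps: "(cyc_step \<Sigma> R)\<^sup>*\<^sup>* w' v'"
    using assms(2) unfolding cyc_irreducible_form_def by auto
  from steps show ?thesis
  proof (cases rule: converse_rtranclpE)
    case base
    \<comment> \<open>The word \<open>v'\<close> is \<open>w'\<close>, which \<open>w\<close> need
      not reach by steps; but a step from \<open>w\<close> would be one from \<open>w'\<close>, so
      \<open>w\<close> is its own form and serves as the witness.\<close>
    then have "cyc_irreducible \<Sigma> R w"
      using irr cyc_step_cyc_conj[OF cyc_conj_sym[OF assms(1)]]
      unfolding cyc_irreducible_iff_no_cyc_step by blast
    then show ?thesis
      using base assms(1) unfolding cyc_irreducible_form_def by blast
  next
    case (step y)
    then have "(cyc_step \<Sigma> R)\<^sup>*\<^sup>* w v'"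
      using cyc_step_cyc_conj[OF assms(1)] by (metis converse_rtranclp_into_rtranclp)
    then show ?thesis
      using irr cyc_conj_refl unfolding cyc_irreducible_form_def by blast
  qed
qed

theorem proposition2p11:
  fixes \<Sigma> :: "'a set" and R :: "('a list \<times> 'a list) set"
  assumes "rewriting_system \<Sigma> R"
    and "complete_rs \<Sigma> R"
    and "reduced_rs \<Sigma> R"
    and "cyc_complete \<Sigma> R"
  shows "\<forall>w\<in>lists \<Sigma>.
           (\<exists>v. cyc_irreducible_form \<Sigma> R w v \<and>
                (\<forall>v'. cyc_irreducible_form \<Sigma> R w v' \<longrightarrow> v' \<bumpeq> v)) \<and>
           (\<forall>w'. w' \<bumpeq> w \<longrightarrow>
                (\<forall>v v'. cyc_irreducible_form \<Sigma> R w v \<and> cyc_irreducible_form \<Sigma> R w' v'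
                   \<longrightarrow> v' \<bumpeq> v))"
proof -
  have "no_infinite_chain (cyc_step \<Sigma> R)" and conf: "cyc_confluent \<Sigma> R"
    using assms(4) unfolding cyc_complete_def by auto
  then have ex: "\<exists>v. cyc_irreducible_form \<Sigma> R w v" for w
    by (simp add: cyc_irreducible_form_exists)
  have same: "v' \<bumpeq> v"
    if "w \<in> lists \<Sigma>" "w' \<bumpeq> w" "cyc_irreducible_form \<Sigma> R w v" "cyc_irreducible_form \<Sigma> R w' v'"
    for w w' v v'
    using cyc_irreducible_form_cyc_conj[OF that(2,4)]
      cyc_irreducible_form_unique[OF conf that(1,3)] cyc_conj_trans by blast
  show ?thesis
    \<comment> \<open>Uniqueness for a single word is the case \<open>w' = w\<close> of
      \<open>same\<close>.\<close>
    using ex same cyc_conj_refl by blast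
qed

end
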